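(* Assume: (a) $U(u,t)$ is nondecreasing in $u$ and in $t$, and $\lim_{t\to+\infty}U(u,t)=+\infty$ for every $u\ge0$; (b) there exist constants $u_*\ge0$, $c_*>0$, $L>0$ such that $U(u,t)\ge u+c_*t$ for all $u\ge u_*$, $t\ge 0$, and $(\alpha/c_* )\int_0^{+\infty}e^{Lz}[1-F(z)]\,dz\le1$. Let $\varphi:[0,+\infty)\to[0,1]$ be the (unique) nondecreasing solution of $\varphi=A\varphi$ with $\lim_{u\to+\infty}\varphi(u)=1$. Let $\varphi^0$ satisfy $1\ge\varphi^0(u)\ge\max\{0,1-e^{-L(u-u_* )}\}$ for all $u\ge0$ and let $\varphi^{k+1}=A\varphi^k$, $k=0,1,\dots$. Then $\|\varphi^k-\varphi\|=\sup_{u\ge0}|\varphi^k(u)-\varphi(u)|$ converges monotonically to zero. Moreover, for every $\varepsilon>0$ there is $q(\varepsilon)$ with $0\le q(\varepsilon)<1$ such that $$\|\varphi^k-\varphi\|\le(q(\varepsilon))^k\,\|\varphi^0-\varphi\|$$ for all $k$ such that $\|\varphi^k-\varphi\|\ge\varepsilon$.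
   Context: $\alpha>0$ is the intensity of the Poisson claim flow; $F$ is the distribution function of claim sizes, $F(z)=0$ for $z\le0$, with finite mean $\mu$. $c(\cdot)\ge0$ is a piecewise continuous premium rate and $U(u,t)$, $u,t\ge0$, is the solution of the Cauchy problem $dU/dt=c(U)$, $U(u,0)=u$, assumed well defined for all $t\ge0$. The operator $A$ acts on bounded Borel functions $\varphi:[0,+\infty)\to\mathbb R$ by $$A\varphi(u)=\int_0^{+\infty}\alpha e^{-\alpha t}\int_0^{U(u,t)}\varphi(U(u,t)-z)\,dF(z)\,dt,\qquad u\ge0,$$ where the inner integral is a Lebesgue–Stieltjes integral over $[0,U(u,t)]$. Under (a), (b) the solution $\varphi$ exists and is unique. All initial functions are Borel measurable. *)

theory Defs
  imports "HOL-Probability.Probability"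
begin

definition claim_df :: "(real \<Rightarrow> real) \<Rightarrow> bool" where
  "claim_df F \<longleftrightarrow>
     mono F \<and> (\<forall>z. continuous (at_right z) F) \<and> (F \<longlongrightarrow> 1) at_top \<and> (\<forall>z\<le>0. F z = 0)"

text \<open>Finitely many discontinuities on every bounded interval, all with finite one-sided limits.
  At \<open>s = 0\<close> the left limit is vacuous, since \<open>at 0 within {0..<0}\<close> is the bottom filter.\<close>

definition piecewise_continuous :: "(real \<Rightarrow> real) \<Rightarrow> bool" where
  "piecewise_continuous c \<longleftrightarrow>
     (\<forall>T>0. \<exists>S. finite S \<and> S \<subseteq> {0..T} \<and> continuous_on ({0..T} - S) c \<and>
        (\<forall>s\<in>S. (\<exists>l. (c \<longlongrightarrow> l) (at s within {0..<s})) \<and>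
               (\<exists>l. (c \<longlongrightarrow> l) (at s within {s<..}))))"

text \<open>As \<open>c\<close> may jump, a solution of \<open>dx/dt = c(x)\<close> can have a kink when it crosses a discontinuity
  of \<open>c\<close>. A solution is therefore a continuous function satisfying the equation at all but finitely
  many times of every bounded interval.\<close>

definition premium_solution :: "(real \<Rightarrow> real) \<Rightarrow> real \<Rightarrow> (real \<Rightarrow> real) \<Rightarrow> bool" where
  "premium_solution c u x \<longleftrightarrow>
     x 0 = u \<and> continuous_on {0..} x \<and> (\<forall>t\<ge>0. 0 \<le> x t) \<and>
     (\<forall>T>0. \<exists>S. finite S \<and>
        (\<forall>t\<in>{0..T} - S. (x has_real_derivative c (x t)) (at t within {0..})))"

definition premium_flow :: "(real \<Rightarrow> real) \<Rightarrow> (real \<Rightarrow> real \<Rightarrow> real) \<Rightarrow> bool" where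
  "premium_flow c U \<longleftrightarrow>
     (\<forall>u\<ge>0. premium_solution c u (U u) \<and>
        (\<forall>x. premium_solution c u x \<longrightarrow> (\<forall>t\<ge>0. x t = U u t)))"

text \<open>Functions on \<open>[0,\<infinity>)\<close> are represented by functions on the reals whose values at
  negative arguments are irrelevant.\<close>

definition risk_op ::
    "real \<Rightarrow> (real \<Rightarrow> real) \<Rightarrow> (real \<Rightarrow> real \<Rightarrow> real) \<Rightarrow> (real \<Rightarrow> real) \<Rightarrow> real \<Rightarrow> real" where
  "risk_op \<alpha> F U \<phi> u =
     (LINT t:{0..}|lborel. \<alpha> * exp (- \<alpha> * t) *
        (LINT z:{0..U u t}|interval_measure F. \<phi> (U u t - z)))"

definition sup_norm :: "(real \<Rightarrow> real) \<Rightarrow> real" where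
  "sup_norm f = (SUP u\<in>{0..}. \<bar>f u\<bar>)"

end

theory Submission
  imports Defs
begin

text \<open>
  On \<open>[0,\<infinity>)\<close> the operator is an expectation, \<open>A f(u) = E f(U(u,t) - z)\<close> with \<open>f\<close> extended by 0 to
  the negative axis, \<open>t\<close> exponential and \<open>z\<close> a claim; so it is positive and nonexpansive for the
  sup norm. The function \<open>\<psi>(u) = max 0 (1 - exp (- L (u - ustar)))\<close> satisfies \<open>A \<psi> \<ge> \<psi>\<close>, because
  \<open>E exp (L z) = 1 + L \<integral> exp (L s) (1 - F s) ds \<le> 1 + L cstar / \<alpha>\<close>. Hence all iterates and \<open>\<phi>\<close>
  lie between \<open>\<psi>\<close> and 1, and their distance is at most \<open>\<epsilon>/2\<close> beyond some \<open>M\<close>, uniformly in \<open>k\<close>.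
  One step of the process reaches \<open>[M,\<infinity>)\<close> with probability at least some \<open>p > 0\<close> from every
  starting point, so as long as the error is at least \<open>\<epsilon>\<close> it shrinks by the factor \<open>1 - p/2\<close>.
\<close>

section \<open>Joint measurability and the sup norm\<close>

text \<open>Rounding the second argument down to the grid of mesh \<open>1 / Suc n\<close> leaves,
  on each strip between grid points, a monotone function of the first argument alone. Continuity in
  the second argument makes these approximants converge pointwise.\<close>

lemma borel_measurable_pair_of_mono_continuous:
  fixes g :: "real \<Rightarrow> real \<Rightarrow> real"
  assumes mono: "\<And>t. mono (\<lambda>u. g u t)" and cont: "\<And>u. continuous_on UNIV (g u)"
  shows "(\<lambda>p. g (fst p) (snd p)) \<in> borel_measurable (borel \<Otimes>\<^sub>M borel)"
proof (rule borel_measurable_LIMSEQ_real)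
  let ?r = "\<lambda>(n::nat) (t::real). real_of_int \<lfloor>t * Suc n\<rfloor> / Suc n"
  fix p :: "real \<times> real"
  have "(\<lambda>n. ?r n (snd p)) \<longlonglongrightarrow> snd p"
  proof (rule tendsto_sandwich)
    have "(\<lambda>n. inverse (real (Suc n))) \<longlonglongrightarrow> 0"
      by (rule LIMSEQ_inverse_real_of_nat)
    then show "(\<lambda>n. snd p - inverse (real (Suc n))) \<longlonglongrightarrow> snd p"
      by (auto intro: tendsto_eq_intros)
    have "snd p - inverse (real (Suc n)) \<le> ?r n (snd p)" for n
    proof -
      have "snd p - inverse (real (Suc n)) = (snd p * Suc n - 1) / Suc n"
        by (simp add: field_simps del: of_nat_Suc)
      also have "\<dots> \<le> ?r n (snd p)"
        by (rule divide_right_mono) linarith+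
      finally show ?thesis .
    qed
    then show "\<forall>\<^sub>F n in sequentially. snd p - inverse (real (Suc n)) \<le> ?r n (snd p)"
      by simp
    show "\<forall>\<^sub>F n in sequentially. ?r n (snd p) \<le> snd p"
      by (simp add: pos_divide_le_eq del: of_nat_Suc)
  qed simp
  moreover have "isCont (g (fst p)) (snd p)"
    using cont by (simp add: continuous_on_eq_continuous_at)
  ultimately show "(\<lambda>n. g (fst p) (?r n (snd p))) \<longlonglongrightarrow> g (fst p) (snd p)"
    using isCont_tendsto_compose by blast
next
  fix n :: nat
  have [measurable]: "(\<lambda>u. g u t) \<in> borel_measurable borel" for t
    by (rule borel_measurable_mono[OF mono])
  \<comment> \<open>The floor takes countably many values, and for each fixed value \<open>i\<close>
    only a monotone section in \<open>u\<close> remains.\<close>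
  have "(\<lambda>p::real\<times>real. (\<lambda>(i::int) p. g (fst p) (real_of_int i / Suc n))
      \<lfloor>snd p * Suc n\<rfloor> p) \<in> borel_measurable (borel \<Otimes>\<^sub>M borel)"
    by (rule measurable_compose_countable) measurable
  then show "(\<lambda>p::real\<times>real. g (fst p) (real_of_int \<lfloor>snd p * Suc n\<rfloor> / Suc n))
      \<in> borel_measurable (borel \<Otimes>\<^sub>M borel)" by simp
qed

lemma sup_norm_le: "(\<And>u. 0 \<le> u \<Longrightarrow> \<bar>f u\<bar> \<le> b) \<Longrightarrow> sup_norm f \<le> b"
  unfolding sup_norm_def by (rule cSUP_least) auto

lemma abs_le_sup_norm:
  assumes "\<And>u. 0 \<le> u \<Longrightarrow> \<bar>f u\<bar> \<le> b" "0 \<le> u"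
  shows "\<bar>f u\<bar> \<le> sup_norm f"
  unfolding sup_norm_def using assms by (intro cSUP_upper) (auto intro!: bdd_aboveI)

lemma set_borel_measurable_mono_on:
  fixes f :: "real \<Rightarrow> real"
  assumes "mono_on {0..} f"
  shows "set_borel_measurable borel {0..} f"
  using borel_measurable_mono_on_fnc[OF assms]
  by (simp add: set_borel_measurable_def borel_measurable_restrict_space_iff)

section \<open>The operator as an expectation over a waiting time and a claim\<close>

locale risk_model =
  fixes \<alpha> :: real and F :: "real \<Rightarrow> real" and U :: "real \<Rightarrow> real \<Rightarrow> real"
  assumes \<alpha>_pos: "0 < \<alpha>"
    and df: "claim_df F"
    and U_mono: "\<And>u v t. 0 \<le> u \<Longrightarrow> u \<le> v \<Longrightarrow> 0 \<le> t \<Longrightarrow> U u t \<le> U v t"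
    and U_cont: "\<And>u. 0 \<le> u \<Longrightarrow> continuous_on {0..} (U u)"
    and U_nonneg: "\<And>u t. 0 \<le> u \<Longrightarrow> 0 \<le> t \<Longrightarrow> 0 \<le> U u t"
    and U_at_top: "filterlim (U 0) at_top at_top"
begin

abbreviation wait_law :: "real measure" where
  "wait_law \<equiv> density lborel (exponential_density \<alpha>)"

abbreviation claim_law :: "real measure" where
  "claim_law \<equiv> interval_measure F"

text \<open>Clamping both arguments at 0 extends \<open>U\<close> to the whole plane while keeping
  it monotone in \<open>u\<close> and continuous in \<open>t\<close>, as the joint measurability
  lemma asks.\<close>

definition flow :: "real \<Rightarrow> real \<Rightarrow> real" where
  "flow u t = U (max 0 u) (max 0 t)"

text \<open>The surplus right after the first claim, where \<omega> pairs the waiting time with the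
  claim size.\<close>

definition surplus :: "real \<Rightarrow> real \<times> real \<Rightarrow> real" where
  "surplus u \<omega> = flow u (fst \<omega>) - snd \<omega>"

text \<open>The value 0 below the origin stands for ruin. It lets the inner integral run over all
  claims instead of over \<open>{0..U u t}\<close>, a domain that depends on \<open>u\<close> and
  \<open>t\<close>.\<close>

definition zero_ext :: "(real \<Rightarrow> real) \<Rightarrow> real \<Rightarrow> real" where
  "zero_ext f x = indicator {0..} x * f x"

definition admissible :: "(real \<Rightarrow> real) \<Rightarrow> bool" where
  "admissible f \<longleftrightarrow> zero_ext f \<in> borel_measurable borel \<and> (\<forall>u\<ge>0. 0 \<le> f u \<and> f u \<le> 1)"

lemma F_facts: "x \<le> y \<Longrightarrow> F x \<le> F y" "continuous (at_right x) F" "(F \<longlongrightarrow> 1) at_top"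
    "z \<le> 0 \<Longrightarrow> F z = 0" "(F \<longlongrightarrow> 0) at_bot"
proof -
  show "(F \<longlongrightarrow> 0) at_bot"
    using df unfolding claim_df_def
    by (intro tendsto_eventually eventually_at_bot_linorderI[of 0]) auto
qed (use df in \<open>auto simp: claim_df_def mono_def\<close>)

sublocale claim: prob_space claim_law
  using real_distribution_interval_measure[OF F_facts(1,2) F_facts(5) F_facts(3)]
  by (simp add: real_distribution_def)

sublocale wait: prob_space wait_law
  using \<alpha>_pos by (rule prob_space_exponential_density)

sublocale pair: pair_prob_space wait_law claim_law ..

lemma measure_claim_Iic: "claim.prob {..x} = F x"
  by (intro measure_interval_measure_Iic F_facts)

lemma AE_claim_pos: "AE z in claim_law. 0 < z"
proof (rule AE_I)
  show "emeasure claim_law {..0} = 0"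
    using measure_claim_Iic[of 0] F_facts(4)[of 0] by (simp add: claim.emeasure_eq_measure)
qed auto

lemma AE_wait_nonneg: "AE t in wait_law. 0 \<le> t"
  by (subst AE_density) (auto simp: exponential_density_def)

lemma measurable_flow: "(\<lambda>p. flow (fst p) (snd p)) \<in> borel_measurable (borel \<Otimes>\<^sub>M borel)"
proof (rule borel_measurable_pair_of_mono_continuous)
  show "mono (\<lambda>u. flow u t)" for t
    by (auto simp: mono_def flow_def intro!: U_mono)
  have "continuous_on UNIV (U (max 0 u) \<circ> max 0)" for u
    by (rule continuous_on_compose)
      (auto intro!: continuous_intros continuous_on_subset[OF U_cont])
  then show "continuous_on UNIV (flow u)" for u
    by (simp add: flow_def[abs_def] comp_def)
qed

lemma measurable_flow' [measurable (raw)]: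
  assumes "f \<in> borel_measurable M" "g \<in> borel_measurable M"
  shows "(\<lambda>x. flow (f x) (g x)) \<in> borel_measurable M"
  using measurable_compose[OF measurable_Pair[OF assms] measurable_flow] by simp

lemma measurable_surplus [measurable]:
  "surplus u \<in> borel_measurable (wait_law \<Otimes>\<^sub>M claim_law)"
  unfolding surplus_def[abs_def] by measurable

lemma zero_ext_bounds:
  assumes "admissible f"
  shows "0 \<le> zero_ext f x" "zero_ext f x \<le> 1"
  using assms by (auto simp: admissible_def zero_ext_def indicator_def)

lemma measurable_zero_ext: "admissible f \<Longrightarrow> zero_ext f \<in> borel_measurable borel"
  by (simp add: admissible_def)

lemma integrable_zero_ext_surplus:
  assumes "admissible f"
  shows "integrable (wait_law \<Otimes>\<^sub>M claim_law) (\<lambda>\<omega>. zero_ext f (surplus u \<omega>))"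
  using zero_ext_bounds[OF assms]
  by (intro pair.integrable_const_bound[of _ 1] AE_I2 measurable_compose[OF measurable_surplus]
      measurable_zero_ext assms) auto

text \<open>Claims above \<open>U u t\<close> contribute nothing because of the zero extension, and
  nonpositive claims form a null set because \<open>F 0 = 0\<close>. The weight
  \<open>\<alpha> * exp (- \<alpha> * t)\<close> is the exponential density on the nonnegative
  axis.\<close>

lemma risk_op_iterated:
  assumes f: "admissible f" and u: "0 \<le> u"
  shows "risk_op \<alpha> F U f u = (\<integral>t. (\<integral>z. zero_ext f (flow u t - z) \<partial>claim_law) \<partial>wait_law)"
proof -
  note measurable_zero_ext[OF f, measurable]
  have inner: "(LINT z:{0..U u t}|claim_law. f (U u t - z))
      = (\<integral>z. zero_ext f (flow u t - z) \<partial>claim_law)" (is "?l = ?r") if "0 \<le> t" for t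
  proof -
    have eq: "?l = (\<integral>z. indicator {0..} z * zero_ext f (flow u t - z) \<partial>claim_law)"
      unfolding set_lebesgue_integral_def using u that
      by (intro Bochner_Integration.integral_cong)
        (auto simp: zero_ext_def flow_def indicator_def)
    show ?thesis
      unfolding eq using AE_claim_pos
      by (intro integral_cong_AE) (measurable, auto elim!: eventually_mono)
  qed
  have "risk_op \<alpha> F U f u
      = (\<integral>t. exponential_density \<alpha> t *\<^sub>R (\<integral>z. zero_ext f (flow u t - z) \<partial>claim_law) \<partial>lborel)"
    unfolding risk_op_def set_lebesgue_integral_def[of lborel]
    by (intro Bochner_Integration.integral_cong)
      (auto simp: exponential_density_def indicator_def inner mult.commute)
  also have "\<dots> = (\<integral>t. (\<integral>z. zero_ext f (flow u t - z) \<partial>claim_law) \<partial>wait_law)"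
    using \<alpha>_pos by (intro integral_density[symmetric]) (auto simp: exponential_density_nonneg)
  finally show ?thesis .
qed

lemma risk_op_expectation:
  assumes "admissible f" "0 \<le> u"
  shows "risk_op \<alpha> F U f u = pair.expectation (\<lambda>\<omega>. zero_ext f (surplus u \<omega>))"
  using pair.integral_fst'[OF integrable_zero_ext_surplus[OF assms(1)]] assms
  by (simp add: risk_op_iterated surplus_def)

text \<open>Measurability in \<open>u\<close> of the parametrised integral comes from the joint
  measurability of \<open>flow\<close>. The bounds pass through the expectation since both laws are
  probabilities.\<close>

lemma admissible_risk_op:
  assumes f: "admissible f"
  shows "admissible (risk_op \<alpha> F U f)"
proof -
  note measurable_zero_ext[OF f, measurable]
  have "(\<lambda>u. indicator {0..} u * (\<integral>t. (\<integral>z. zero_ext f (flow u t - z) \<partial>claim_law) \<partial>wait_law))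
      \<in> borel_measurable borel"
    by measurable
  also have "(\<lambda>u. indicator {0..} u * (\<integral>t. (\<integral>z. zero_ext f (flow u t - z) \<partial>claim_law) \<partial>wait_law))
      = zero_ext (risk_op \<alpha> F U f)"
    by (auto simp: zero_ext_def[of "risk_op \<alpha> F U f"] fun_eq_iff indicator_def
        risk_op_iterated[OF f])
  finally have "zero_ext (risk_op \<alpha> F U f) \<in> borel_measurable borel" .
  moreover have "0 \<le> risk_op \<alpha> F U f u" "risk_op \<alpha> F U f u \<le> 1" if "0 \<le> u" for u
    using zero_ext_bounds[OF f] that
    by (auto simp: risk_op_expectation[OF f]
        intro!: Bochner_Integration.integral_nonneg pair.integral_le_const
        integrable_zero_ext_surplus f)
  ultimately show ?thesis by (simp add: admissible_def)
qed

lemma risk_op_mono: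
  assumes "admissible f" "admissible g" "\<And>x. 0 \<le> x \<Longrightarrow> f x \<le> g x" "0 \<le> u"
  shows "risk_op \<alpha> F U f u \<le> risk_op \<alpha> F U g u"
proof -
  have "zero_ext f x \<le> zero_ext g x" for x
    using assms(3) by (simp add: zero_ext_def indicator_def)
  then show ?thesis
    using assms by (auto simp: risk_op_expectation intro!: integral_mono integrable_zero_ext_surplus)
qed

section \<open>One-step contraction by escape to large surplus\<close>

text \<open>Since \<open>U u t \<ge> U 0 t\<close>, a late and small first claim leaves the surplus above \<open>M\<close> with a
  probability that is bounded below uniformly in \<open>u\<close>.\<close>

lemma overshoot:
  fixes M :: real
  obtains G where "G \<in> sets (wait_law \<Otimes>\<^sub>M claim_law)" "0 < pair.prob G"
    "\<And>(u::real) \<omega>. 0 \<le> u \<Longrightarrow> \<omega> \<in> G \<Longrightarrow> M \<le> surplus u \<omega>"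
proof -
  have "\<forall>\<^sub>F z in at_top. 0 < F z"
    using F_facts(3) by (rule order_tendstoD) simp
  then obtain Z where Z: "0 < F Z" by (auto simp: eventually_at_top_linorder)
  have "\<forall>\<^sub>F t in at_top. M + Z \<le> U 0 t"
    using U_at_top by (simp add: filterlim_at_top)
  then obtain T0 where T0: "\<And>t. T0 \<le> t \<Longrightarrow> M + Z \<le> U 0 t"
    by (auto simp: eventually_at_top_linorder)
  \<comment> \<open>Nonnegativity of \<open>T\<close> gives access to the exponential tail formula
    and makes \<open>flow\<close> agree with \<open>U\<close> at times beyond
    \<open>T\<close>.\<close>
  define T where "T = max 0 T0"
  have "distributed wait_law lborel (\<lambda>t. t) (exponential_density \<alpha>)"
    unfolding distributed_def by (auto simp: distr_id2)
  from wait.exponential_distributedD_gt[OF this, of T] \<alpha>_pos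
  have T: "wait.prob {T<..} > 0" by (simp add: T_def greaterThan_def)
  show ?thesis
  proof (rule that[of "{T<..} \<times> {..Z}"])
    show "0 < pair.prob ({T<..} \<times> {..Z})"
      using T Z measure_claim_Iic[of Z]
      by (simp add: measure_def claim.emeasure_pair_measure_Times enn2real_mult)
    fix u :: real and \<omega> assume u: "0 \<le> u" and w: "\<omega> \<in> {T<..} \<times> {..Z}"
    then have "M + Z \<le> U 0 (fst \<omega>)" "0 \<le> fst \<omega>" by (auto simp: T_def intro!: T0)
    then show "M \<le> surplus u \<omega>"
      using U_mono[of 0 u "fst \<omega>"] u w by (auto simp: surplus_def flow_def)
  qed auto
qed

text \<open>Under the expectation the difference is at most \<open>d\<close> on the overshoot event
  and at most \<open>D\<close> elsewhere; after ruin both extensions vanish, whence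
  \<open>0 \<le> D\<close>. The constant \<open>p\<close> is the probability of that event. It is
  chosen from \<open>M\<close> before the functions and bounds, so one \<open>p\<close> serves all
  iterates.\<close>

lemma risk_op_diff_le:
  assumes "0 \<le> M"
  obtains p where "0 < p" "p \<le> 1"
    "\<And>f g D d u. \<lbrakk>admissible f; admissible g; 0 \<le> D; d \<le> D; \<And>x. 0 \<le> x \<Longrightarrow> f x - g x \<le> D;
       \<And>x. M \<le> x \<Longrightarrow> f x - g x \<le> d; 0 \<le> u\<rbrakk>
     \<Longrightarrow> risk_op \<alpha> F U f u - risk_op \<alpha> F U g u \<le> D - p * (D - d)"
proof -
  obtain G where G_sets [measurable]: "G \<in> sets (wait_law \<Otimes>\<^sub>M claim_law)" and pos: "0 < pair.prob G"
    and G: "\<And>u \<omega>. 0 \<le> u \<Longrightarrow> \<omega> \<in> G \<Longrightarrow> M \<le> surplus u \<omega>"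
    using overshoot by blast
  show thesis
  proof (rule that[of "pair.prob G"])
    fix f g :: "real \<Rightarrow> real" and D d u :: real
    assume f: "admissible f" and g: "admissible g" and D: "0 \<le> D" "d \<le> D"
      and le: "\<And>x. 0 \<le> x \<Longrightarrow> f x - g x \<le> D" "\<And>x. M \<le> x \<Longrightarrow> f x - g x \<le> d" and u: "0 \<le> u"
    note int = integrable_zero_ext_surplus[OF f, of u] integrable_zero_ext_surplus[OF g, of u]
    have int_G: "integrable (wait_law \<Otimes>\<^sub>M claim_law) (indicat_real G)"
      by (rule pair.integrable_const_bound[of _ 1]) auto
    have "risk_op \<alpha> F U f u - risk_op \<alpha> F U g u
        = pair.expectation (\<lambda>\<omega>. zero_ext f (surplus u \<omega>) - zero_ext g (surplus u \<omega>))"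
      using int f g u by (simp add: risk_op_expectation)
    also have "\<dots> \<le> pair.expectation (\<lambda>\<omega>. D - (D - d) * indicator G \<omega>)"
    proof (rule integral_mono)
      show "integrable (wait_law \<Otimes>\<^sub>M claim_law) (\<lambda>\<omega>. D - (D - d) * indicator G \<omega>)"
        using int_G by auto
      fix \<omega>
      show "zero_ext f (surplus u \<omega>) - zero_ext g (surplus u \<omega>) \<le> D - (D - d) * indicator G \<omega>"
        using G[OF u, of \<omega>] le[of "surplus u \<omega>"] D assms
        by (auto simp: zero_ext_def indicator_def)
    qed (use int in auto)
    also have "\<dots> = D - pair.prob G * (D - d)"
      using int_G sets.Int_space_eq2[OF G_sets]
      by (subst Bochner_Integration.integral_diff) (auto simp: pair.prob_space)
    finally show "risk_op \<alpha> F U f u - risk_op \<alpha> F U g u \<le> D - pair.prob G * (D - d)" .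
  qed (use pos in auto)
qed

section \<open>Exponential moments and the Lundberg bound\<close>

text \<open>For \<open>z > 0\<close>, \<open>exp (L * z)\<close> is 1 plus the integral of
  \<open>L * exp (L * s)\<close> over \<open>s\<close> from 0 to \<open>z\<close>. Exchanging the
  integrals turns the event \<open>s < z\<close> into the tail \<open>1 - F s\<close>. The
  computation is done with nonnegative integrals, so that finiteness, and hence integrability, is a
  result of it.\<close>

lemma claim_mgf:
  assumes L: "0 < L" and int: "set_integrable lborel {0..} (\<lambda>z. exp (L * z) * (1 - F z))"
  shows "integrable claim_law (\<lambda>z. exp (L * z))"
    and "claim.expectation (\<lambda>z. exp (L * z)) = 1 + L * (LINT z:{0..}|lborel. exp (L * z) * (1 - F z))"
proof -
  interpret pair_sigma_finite claim_law lborel ..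
  let ?I = "LINT z:{0..}|lborel. exp (L * z) * (1 - F z)"
  have F_le_1: "F s \<le> 1" for s
    using claim.prob_le_1[of "{..s}"] by (simp add: measure_claim_Iic)
  have I_nonneg: "0 \<le> ?I"
    unfolding set_lebesgue_integral_def using F_le_1 by (intro Bochner_Integration.integral_nonneg) auto
  have tail: "emeasure claim_law {s<..} = ennreal (1 - F s)" for s
    using claim.prob_compl[of "{..s}"] measure_claim_Iic[of s]
    by (simp add: claim.emeasure_eq_measure Compl_eq_Diff_UNIV[symmetric])
  have tail': "(\<integral>\<^sup>+z. of_bool (s < z) \<partial>claim_law) = ennreal (1 - F s)" for s
  proof -
    have "(\<lambda>z. of_bool (s < z)) = (indicator {s<..} :: real \<Rightarrow> ennreal)"
      by (auto simp: indicator_def)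
    then show ?thesis by (simp add: tail)
  qed
  \<comment> \<open>The interval is half-open to match the strict tail \<open>{s<..}\<close>, whose
    mass is exactly \<open>1 - F s\<close> even at an atom; the endpoint is Lebesgue-null.\<close>
  have FTC: "ennreal (exp (L * z)) = 1 + (\<integral>\<^sup>+s. ennreal (L * exp (L * s)) * indicator {0..<z} s \<partial>lborel)"
    if "0 < z" for z
  proof -
    have "(\<integral>\<^sup>+s. ennreal (L * exp (L * s)) * indicator {0..<z} s \<partial>lborel)
        = (\<integral>\<^sup>+s. ennreal (L * exp (L * s)) * indicator {0..z} s \<partial>lborel)"
      using AE_lborel_singleton[of z]
      by (intro nn_integral_cong_AE) (auto elim!: eventually_mono simp: indicator_def)
    also have "\<dots> = ennreal (exp (L * z) - exp (L * 0))"
      using that L by (intro nn_integral_FTC_Icc) (auto intro!: derivative_eq_intros)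
    finally show ?thesis
      using that L by (simp add: ennreal_1[symmetric] ennreal_plus[symmetric] del: ennreal_1 ennreal_plus)
  qed
  have "(\<integral>\<^sup>+z. ennreal (exp (L * z)) \<partial>claim_law)
      = (\<integral>\<^sup>+z. 1 + (\<integral>\<^sup>+s. ennreal (L * exp (L * s)) * indicator {0..<z} s \<partial>lborel) \<partial>claim_law)"
    using AE_claim_pos by (intro nn_integral_cong_AE) (auto elim!: eventually_mono simp: FTC)
  also have "\<dots> = 1 + (\<integral>\<^sup>+z. (\<integral>\<^sup>+s. ennreal (L * exp (L * s)) * (indicator {0..} s * indicator {s<..} z) \<partial>lborel) \<partial>claim_law)"
  proof -
    have ind: "indicator {0..<z} s = (indicator {0..} s * indicator {s<..} z :: ennreal)" for z s :: real
      by (auto simp: indicator_def)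
    have [measurable (raw)]: "(\<lambda>x. indicator {f x<..} (g x) :: ennreal) \<in> borel_measurable M"
      if "f \<in> borel_measurable M" "g \<in> borel_measurable M" for f g :: "'x \<Rightarrow> real" and M
      unfolding indicator_def greaterThan_iff using that by measurable
    show ?thesis
      unfolding ind by (subst nn_integral_add) (auto simp: claim.emeasure_space_1[simplified])
  qed
  also have "(\<integral>\<^sup>+z. (\<integral>\<^sup>+s. ennreal (L * exp (L * s)) * (indicator {0..} s * indicator {s<..} z) \<partial>lborel) \<partial>claim_law)
      = (\<integral>\<^sup>+s. (\<integral>\<^sup>+z. ennreal (L * exp (L * s)) * (indicator {0..} s * indicator {s<..} z) \<partial>claim_law) \<partial>lborel)"
    unfolding indicator_def greaterThan_iff by (intro Fubini'[symmetric]) measurable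
  also have "\<dots> = (\<integral>\<^sup>+s. ennreal (L * (indicator {0..} s *\<^sub>R (exp (L * s) * (1 - F s)))) \<partial>lborel)"
    using L F_le_1
    by (intro nn_integral_cong)
      (auto simp: nn_integral_cmult mult.assoc[symmetric] tail' indicator_def ennreal_mult)
  also have "\<dots> = ennreal (L * ?I)"
    unfolding set_lebesgue_integral_def using int L F_le_1
    by (subst nn_integral_eq_integral) (auto simp: set_integrable_def)
  finally have eq: "(\<integral>\<^sup>+z. ennreal (exp (L * z)) \<partial>claim_law) = ennreal (1 + L * ?I)"
    using I_nonneg L by simp
  then show "integrable claim_law (\<lambda>z. exp (L * z))"
    by (intro integrableI_nn_integral_finite[of _ _ "1 + L * ?I"]) auto
  show "claim.expectation (\<lambda>z. exp (L * z)) = 1 + L * ?I"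
    using I_nonneg L by (subst integral_eq_nn_integral) (auto simp: eq simp del: ennreal_plus)
qed

text \<open>Exponential tilting: the density of rate \<alpha> times \<open>exp (- s * t)\<close> is
  a multiple of the density of rate \<open>\<alpha> + s\<close>, which has total mass 1.\<close>

lemma wait_laplace:
  assumes "0 \<le> s"
  shows "integrable wait_law (\<lambda>t. exp (- s * t))"
    and "wait.expectation (\<lambda>t. exp (- s * t)) = \<alpha> / (\<alpha> + s)"
proof -
  have pos: "0 < \<alpha> + s" using \<alpha>_pos assms by simp
  have eq: "exponential_density \<alpha> t * exp (- (s * t))
      = \<alpha> / (\<alpha> + s) * exponential_density (\<alpha> + s) t" for t
    using pos by (simp add: exponential_density_def exp_add[symmetric]) (simp add: algebra_simps)
  interpret E: prob_space "density lborel (exponential_density (\<alpha> + s))"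
    using pos by (rule prob_space_exponential_density)
  have 1: "integrable lborel (exponential_density (\<alpha> + s))"
    using E.integrable_const[of "1::real"] pos by (subst (asm) integrable_density) (auto simp: exponential_density_nonneg)
  have 2: "integral\<^sup>L lborel (exponential_density (\<alpha> + s)) = 1"
    using E.prob_space integral_density[of "\<lambda>_. 1::real" lborel "exponential_density (\<alpha> + s)"] pos
    by (auto simp: exponential_density_nonneg)
  show "integrable wait_law (\<lambda>t. exp (- s * t))"
    using \<alpha>_pos 1 by (subst integrable_density) (auto simp: exponential_density_nonneg eq)
  show "wait.expectation (\<lambda>t. exp (- s * t)) = \<alpha> / (\<alpha> + s)"
    using \<alpha>_pos 2 by (subst integral_density) (auto simp: exponential_density_nonneg eq)
qed

text \<open>Below \<open>ustar\<close> the function vanishes and positivity of the operator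
  suffices. Above it, \<open>growth\<close> bounds the expectation of
  \<open>exp (- L * (surplus - ustar))\<close> by its initial value times the claim moment times
  \<open>\<alpha> / (\<alpha> + L * cstar)\<close>, and the moment condition makes the product of
  these two factors at most 1.\<close>

lemma lundberg_subsolution:
  fixes ustar cstar L :: real
  defines "\<psi> \<equiv> \<lambda>u. max 0 (1 - exp (- L * (u - ustar)))"
  assumes ustar: "0 \<le> ustar" and cstar: "0 < cstar" and L: "0 < L"
    and growth: "\<And>u t. ustar \<le> u \<Longrightarrow> 0 \<le> t \<Longrightarrow> u + cstar * t \<le> U u t"
    and int: "set_integrable lborel {0..} (\<lambda>z. exp (L * z) * (1 - F z))"
    and cramer: "\<alpha> / cstar * (LINT z:{0..}|lborel. exp (L * z) * (1 - F z)) \<le> 1"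
    and u: "0 \<le> u"
  shows "admissible \<psi>" and "\<psi> u \<le> risk_op \<alpha> F U \<psi> u"
proof -
  show adm: "admissible \<psi>"
    unfolding admissible_def zero_ext_def[abs_def] \<psi>_def by auto
  note measurable_zero_ext[OF adm, measurable]
  let ?m = "claim.expectation (\<lambda>z. exp (L * z))"
  have m: "\<alpha> * ?m \<le> \<alpha> + L * cstar"
    using cramer cstar L unfolding claim_mgf(2)[OF L int] by (simp add: field_simps)
  have m0: "0 \<le> ?m" by (intro Bochner_Integration.integral_nonneg) auto
  show "\<psi> u \<le> risk_op \<alpha> F U \<psi> u"
  proof (cases "ustar \<le> u")
    case False
    then have "\<psi> u = 0" using L by (simp add: \<psi>_def mult_le_0_iff)
    then show ?thesis using admissible_risk_op[OF adm] u by (simp add: admissible_def)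
  next
    case True
    define K where "K = exp (- L * (u - ustar))"
    \<comment> \<open>This holds on the whole line: for negative \<open>x\<close>, where the
      extension is 0, the left side is at most 0 since \<open>ustar\<close> is nonnegative.\<close>
    have ext: "1 - exp (- L * (x - ustar)) \<le> zero_ext \<psi> x" for x
      using ustar L by (auto simp: zero_ext_def \<psi>_def indicator_def mult_le_0_iff)
    have inner: "1 - ?m * exp (- L * (x - ustar)) \<le> (\<integral>z. zero_ext \<psi> (x - z) \<partial>claim_law)" for x
    proof -
      have "1 - ?m * exp (- L * (x - ustar))
          = (\<integral>z. 1 - exp (L * z) * exp (- L * (x - ustar)) \<partial>claim_law)"
        using claim_mgf(1)[OF L int] by (simp add: claim.prob_space[simplified])
      also have "\<dots> \<le> (\<integral>z. zero_ext \<psi> (x - z) \<partial>claim_law)"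
      proof (rule integral_mono)
        show "integrable claim_law (\<lambda>z. 1 - exp (L * z) * exp (- L * (x - ustar)))"
          using claim_mgf(1)[OF L int] by auto
        show "integrable claim_law (\<lambda>z. zero_ext \<psi> (x - z))"
          using zero_ext_bounds[OF adm] by (intro claim.integrable_const_bound[of _ 1]) auto
        show "1 - exp (L * z) * exp (- L * (x - ustar)) \<le> zero_ext \<psi> (x - z)" for z
          using ext[of "x - z"] by (simp add: exp_add[symmetric] algebra_simps)
      qed
      finally show ?thesis .
    qed
    have "?m * (\<alpha> / (\<alpha> + L * cstar)) \<le> 1"
      using m \<alpha>_pos L cstar by (simp add: pos_divide_le_eq add_pos_pos mult.commute)
    then have "K * (?m * (\<alpha> / (\<alpha> + L * cstar))) \<le> K * 1"
      by (intro mult_left_mono) (auto simp: K_def)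
    then have "1 - K \<le> 1 - ?m * K * (\<alpha> / (\<alpha> + L * cstar))"
      by (simp only: mult_ac mult_1_right)
    also have "\<dots> = wait.expectation (\<lambda>t. 1 - ?m * K * exp (- (L * cstar) * t))"
      using wait_laplace[of "L * cstar"] L cstar by (simp add: wait.prob_space[simplified])
    also have "\<dots> \<le> wait.expectation (\<lambda>t. (\<integral>z. zero_ext \<psi> (flow u t - z) \<partial>claim_law))"
    proof (rule integral_mono_AE)
      show "integrable wait_law (\<lambda>t. 1 - ?m * K * exp (- (L * cstar) * t))"
        using wait_laplace(1)[of "L * cstar"] L cstar by auto
      show "integrable wait_law (\<lambda>t. (\<integral>z. zero_ext \<psi> (flow u t - z) \<partial>claim_law))"
        using pair.integrable_fst'[OF integrable_zero_ext_surplus[OF adm, of u]]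
        by (simp add: surplus_def)
      show "AE t in wait_law. 1 - ?m * K * exp (- (L * cstar) * t)
          \<le> (\<integral>z. zero_ext \<psi> (flow u t - z) \<partial>claim_law)"
        using AE_wait_nonneg
      proof eventually_elim
        case (elim t)
        have "K * exp (- (L * cstar) * t) = exp (- L * (u + cstar * t - ustar))"
          by (simp add: K_def exp_add[symmetric] algebra_simps)
        also have "\<dots> \<ge> exp (- L * (flow u t - ustar))"
          using growth[OF True elim] L u elim by (simp add: flow_def)
        finally have "?m * exp (- L * (flow u t - ustar)) \<le> ?m * (K * exp (- (L * cstar) * t))"
          using m0 by (intro mult_left_mono)
        then show ?case using inner[of "flow u t"] by (simp add: mult.assoc)
      qed
    qed
    also have "\<dots> = risk_op \<alpha> F U \<psi> u" by (rule risk_op_iterated[OF adm u, symmetric])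
    finally have "1 - K \<le> risk_op \<alpha> F U \<psi> u" .
    moreover have "0 \<le> risk_op \<alpha> F U \<psi> u"
      using admissible_risk_op[OF adm] u by (simp add: admissible_def)
    ultimately show ?thesis by (simp add: \<psi>_def K_def)
  qed
qed

section \<open>Comparison with the fixed point\<close>

text \<open>A maximum principle. Suppose the supremum \<open>D\<close> of \<open>f - g\<close> is
  positive. As \<open>f \<le> 1\<close> and \<open>g\<close> tends to 1, the difference is at most
  \<open>D / 2\<close> far out, so one application of the operator pushes it everywhere below
  \<open>D\<close> by a fixed amount. The inequality for \<open>f\<close> and the equation for
  \<open>g\<close> carry this back to \<open>f - g\<close>, contradicting the choice of
  \<open>D\<close>.\<close>

lemma subsolution_le_fixed_point:
  assumes f: "admissible f" and sub: "\<And>u. 0 \<le> u \<Longrightarrow> f u \<le> risk_op \<alpha> F U f u"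
    and g: "admissible g" and fixed: "\<And>u. 0 \<le> u \<Longrightarrow> g u = risk_op \<alpha> F U g u"
    and lim: "(g \<longlongrightarrow> 1) at_top" and u0: "0 \<le> u0"
  shows "f u0 \<le> g u0"
proof (rule ccontr)
  assume neg: "\<not> f u0 \<le> g u0"
  define D where "D = (SUP u\<in>{0..}. f u - g u)"
  have bounds: "0 \<le> f u" "f u \<le> 1" "0 \<le> g u" "g u \<le> 1" if "0 \<le> u" for u
    using f g that by (auto simp: admissible_def)
  have "bdd_above ((\<lambda>u. f u - g u) ` {0..})"
    using bounds by (intro bdd_aboveI2[of _ _ 1]) (smt (verit) atLeast_iff)
  then have le: "f u - g u \<le> D" if "0 \<le> u" for u
    unfolding D_def using that by (intro cSUP_upper) auto
  have D: "0 < D" using le[OF u0] neg by simp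
  have "\<forall>\<^sub>F x in at_top. 1 - D / 2 < g x"
    using lim D by (intro order_tendstoD) auto
  then obtain M0 where M0: "\<And>x. M0 \<le> x \<Longrightarrow> 1 - D / 2 < g x"
    by (auto simp: eventually_at_top_linorder)
  define M where "M = max 0 M0"
  have "0 \<le> M" by (simp add: M_def)
  then obtain p where p: "0 < p" and step: "\<And>f g D d u. \<lbrakk>admissible f; admissible g; 0 \<le> D; d \<le> D;
       \<And>x. 0 \<le> x \<Longrightarrow> f x - g x \<le> D; \<And>x. M \<le> x \<Longrightarrow> f x - g x \<le> d; 0 \<le> u\<rbrakk>
     \<Longrightarrow> risk_op \<alpha> F U f u - risk_op \<alpha> F U g u \<le> D - p * (D - d)"
    by (rule risk_op_diff_le) blast
  have "f u - g u \<le> D - p * (D - D / 2)" if u: "0 \<le> u" for u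
  proof -
    have "risk_op \<alpha> F U f u - risk_op \<alpha> F U g u \<le> D - p * (D - D / 2)"
    proof (rule step[OF f g])
      show "f x - g x \<le> D / 2" if "M \<le> x" for x
        using that M0[of x] bounds(2)[of x] by (simp add: M_def)
    qed (use D le u in auto)
    then show ?thesis using sub[OF u] fixed[OF u] by simp
  qed
  then have "D \<le> D - p * (D - D / 2)"
    unfolding D_def by (intro cSUP_least) auto
  then show False using mult_pos_pos[OF p D] by simp
qed

end

section \<open>Geometric decay of the error and convergence\<close>

theorem theorem4p2:
  fixes \<alpha> ustar cstar L :: real
    and F c \<phi> \<phi>0 :: "real \<Rightarrow> real"
    and U :: "real \<Rightarrow> real \<Rightarrow> real"
  assumes "\<alpha> > 0"
    and "claim_df F"
    and "integrable (interval_measure F) (\<lambda>z. z)"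
    and "\<forall>u\<ge>0. c u \<ge> 0"
    and "piecewise_continuous c"
    and "premium_flow c U"
    and "\<forall>u v t. 0 \<le> u \<longrightarrow> u \<le> v \<longrightarrow> 0 \<le> t \<longrightarrow> U u t \<le> U v t"
    and "\<forall>u s t. 0 \<le> u \<longrightarrow> 0 \<le> s \<longrightarrow> s \<le> t \<longrightarrow> U u s \<le> U u t"
    and "\<forall>u\<ge>0. filterlim (U u) at_top at_top"
    and "ustar \<ge> 0" and "cstar > 0" and "L > 0"
    and "\<forall>u\<ge>ustar. \<forall>t\<ge>0. U u t \<ge> u + cstar * t"
    and "set_integrable lborel {0..} (\<lambda>z. exp (L * z) * (1 - F z))"
    and "\<alpha> / cstar * (LINT z:{0..}|lborel. exp (L * z) * (1 - F z)) \<le> 1"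
    and "\<forall>u\<ge>0. 0 \<le> \<phi> u \<and> \<phi> u \<le> 1"
    and "mono_on {0..} \<phi>"
    and "\<forall>u\<ge>0. \<phi> u = risk_op \<alpha> F U \<phi> u"
    and "(\<phi> \<longlongrightarrow> 1) at_top"
    and "set_borel_measurable borel {0..} \<phi>0"
    and "\<forall>u\<ge>0. max 0 (1 - exp (- L * (u - ustar))) \<le> \<phi>0 u \<and> \<phi>0 u \<le> 1"
  defines "err \<equiv> \<lambda>k::nat. sup_norm (\<lambda>u. (risk_op \<alpha> F U ^^ k) \<phi>0 u - \<phi> u)"
  shows "decseq err \<and> err \<longlonglongrightarrow> 0 \<and>
    (\<forall>\<epsilon>>0. \<exists>q. 0 \<le> q \<and> q < 1 \<and> (\<forall>k. err k \<ge> \<epsilon> \<longrightarrow> err k \<le> q ^ k * err 0))"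
proof -
  let ?A = "risk_op \<alpha> F U"
  define \<psi> where "\<psi> = (\<lambda>u. max 0 (1 - exp (- L * (u - ustar))))"
  interpret risk_model \<alpha> F U
    using assms(1,2,6,7,9) by unfold_locales (auto simp: premium_flow_def premium_solution_def)
  have adm\<psi>: "admissible \<psi>" and sub: "\<And>u. 0 \<le> u \<Longrightarrow> \<psi> u \<le> ?A \<psi> u"
    unfolding \<psi>_def using lundberg_subsolution[of ustar cstar L] assms(10-15) by blast+
  have adm\<phi>: "admissible \<phi>"
    using set_borel_measurable_mono_on[OF assms(17)] assms(16)
    by (simp add: admissible_def set_borel_measurable_def zero_ext_def[abs_def])
  have adm0: "admissible \<phi>0"
    using assms(20,21)
    by (simp add: admissible_def set_borel_measurable_def zero_ext_def[abs_def])
  have fixed: "\<phi> u = ?A \<phi> u" if "0 \<le> u" for u using assms(18) that by blast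
  have \<psi>\<phi>: "\<psi> u \<le> \<phi> u" if "0 \<le> u" for u
    using that by (intro subsolution_le_fixed_point[OF adm\<psi> sub adm\<phi> fixed assms(19)])
  define f where "f k = (?A ^^ k) \<phi>0" for k
  have f_Suc: "f (Suc k) = ?A (f k)" for k by (simp add: f_def)
  have adm_f: "admissible (f k)" for k
    by (induction k) (auto simp: f_Suc admissible_risk_op, simp add: f_def adm0)
  have \<psi>f: "0 \<le> u \<Longrightarrow> \<psi> u \<le> f k u" for k u
  proof (induction k arbitrary: u)
    case 0
    then show ?case using assms(21) by (simp add: f_def \<psi>_def)
  next
    case (Suc k)
    have "?A \<psi> u \<le> ?A (f k) u"
      using Suc by (intro risk_op_mono adm\<psi> adm_f) auto
    then show ?case using sub[OF Suc.prems] by (simp add: f_Suc)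
  qed
  \<comment> \<open>The bound does not depend on \<open>k\<close> and vanishes at infinity, which
    gives far-field control of all iterates at once.\<close>
  have dist_le: "\<bar>f k u - \<phi> u\<bar> \<le> 1 - \<psi> u" if "0 \<le> u" for k u
    using \<psi>f[OF that, of k] \<psi>\<phi>[OF that] adm_f[of k] adm\<phi> that
    unfolding admissible_def by (smt (verit))
  have err_eq: "err k = sup_norm (\<lambda>u. f k u - \<phi> u)" for k
    by (simp add: err_def f_def)
  have "\<bar>f k u - \<phi> u\<bar> \<le> 1" if "0 \<le> u" for k u
    using dist_le[OF that, of k] by (simp add: \<psi>_def)
  then have le_err: "\<bar>f k u - \<phi> u\<bar> \<le> err k" if "0 \<le> u" for k u
    unfolding err_eq using that by (rule abs_le_sup_norm)
  have err_nonneg: "0 \<le> err k" for k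
    using le_err[of 0 k] by simp
  \<comment> \<open>Here \<open>p\<close> depends on \<open>M\<close> only. The one-sided estimate
    is used twice, with the roles of the iterate and \<phi> exchanged, to bound the absolute
    value.\<close>
  have contract: "\<exists>p>0. p \<le> 1 \<and> (\<forall>k. \<forall>d\<le>err k. (\<forall>x\<ge>M. \<bar>f k x - \<phi> x\<bar> \<le> d) \<longrightarrow>
      err (Suc k) \<le> err k - p * (err k - d))" if M: "0 \<le> M" for M
  proof -
    obtain p where p: "0 < p" "p \<le> 1" and step: "\<And>f g D d u. \<lbrakk>admissible f; admissible g; 0 \<le> D; d \<le> D;
         \<And>x. 0 \<le> x \<Longrightarrow> f x - g x \<le> D; \<And>x. M \<le> x \<Longrightarrow> f x - g x \<le> d; 0 \<le> u\<rbrakk>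
       \<Longrightarrow> ?A f u - ?A g u \<le> D - p * (D - d)"
      using risk_op_diff_le[OF M] by auto
    have "err (Suc k) \<le> err k - p * (err k - d)"
      if d: "d \<le> err k" and far: "\<forall>x\<ge>M. \<bar>f k x - \<phi> x\<bar> \<le> d" for k d
      unfolding err_eq[of "Suc k"]
    proof (rule sup_norm_le)
      fix u :: real assume u: "0 \<le> u"
      have "?A (f k) u - ?A \<phi> u \<le> err k - p * (err k - d)"
        using le_err[of _ k] far by (intro step adm_f adm\<phi> err_nonneg d u) (auto simp: abs_le_iff)
      moreover have "?A \<phi> u - ?A (f k) u \<le> err k - p * (err k - d)"
        using le_err[of _ k] far by (intro step adm_f adm\<phi> err_nonneg d u) (auto simp: abs_le_iff)
      ultimately show "\<bar>f (Suc k) u - \<phi> u\<bar> \<le> err k - p * (err k - d)"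
        using fixed[OF u] by (simp add: f_Suc abs_le_iff)
    qed
    with p show ?thesis by blast
  qed
  have dec: "decseq err"
  proof (rule decseq_SucI)
    fix k
    \<comment> \<open>With \<open>M = 0\<close> and \<open>d = err k\<close> the gain term vanishes,
      leaving plain nonexpansiveness.\<close>
    obtain p where "\<forall>k. \<forall>d\<le>err k. (\<forall>x\<ge>0. \<bar>f k x - \<phi> x\<bar> \<le> d) \<longrightarrow>
        err (Suc k) \<le> err k - p * (err k - d)"
      using contract[of 0] by auto
    then show "err (Suc k) \<le> err k" using le_err[of _ k] by fastforce
  qed
  have geometric: "\<exists>q. 0 \<le> q \<and> q < 1 \<and> (\<forall>k. err k \<ge> \<epsilon> \<longrightarrow> err k \<le> q ^ k * err 0)"
    if \<epsilon>: "0 < \<epsilon>" for \<epsilon>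
  proof -
    \<comment> \<open>The second entry solves
      \<open>exp (- L * (x - ustar)) = \<epsilon> / 2\<close> for \<open>x\<close>.\<close>
    define M where "M = max 0 (ustar - ln (\<epsilon> / 2) / L)"
    have tail: "\<bar>f k x - \<phi> x\<bar> \<le> \<epsilon> / 2" if "M \<le> x" for k x
    proof -
      have x: "0 \<le> x" "ustar - ln (\<epsilon> / 2) / L \<le> x" using that by (auto simp: M_def)
      have "- L * (x - ustar) \<le> ln (\<epsilon> / 2)"
        using x(2) assms(12) by (simp add: field_simps)
      then have "exp (- L * (x - ustar)) \<le> \<epsilon> / 2"
        using \<epsilon> by (simp add: ln_ge_iff del: mult_minus_left)
      then show ?thesis using dist_le[OF x(1), of k] unfolding \<psi>_def by linarith
    qed
    obtain p where p: "0 < p" "p \<le> 1" and step: "\<And>k d. d \<le> err k \<Longrightarrow>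
        (\<forall>x\<ge>M. \<bar>f k x - \<phi> x\<bar> \<le> d) \<Longrightarrow> err (Suc k) \<le> err k - p * (err k - d)"
      using contract[of M] by (auto simp: M_def)
    have "\<epsilon> \<le> err k \<Longrightarrow> err k \<le> (1 - p / 2) ^ k * err 0" for k
    proof (induction k)
      case (Suc k)
      \<comment> \<open>Monotonicity of the error carries the threshold condition back to the
        previous index, so the induction hypothesis applies.\<close>
      have k: "\<epsilon> \<le> err k" using Suc.prems decseq_SucD[OF dec, of k] by simp
      \<comment> \<open>The far bound is \<open>d = \<epsilon> / 2\<close>. From
        \<open>\<epsilon> \<le> err k\<close> it follows that \<open>err k - \<epsilon> / 2\<close>
        is at least half of \<open>err k\<close>, whence the factor
        \<open>1 - p / 2\<close>.\<close>
      have "err (Suc k) \<le> err k - p * (err k - \<epsilon> / 2)"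
        using tail k \<epsilon> by (intro step) auto
      also have "\<dots> \<le> (1 - p / 2) * err k"
        using mult_left_mono[OF k, of p] p by (simp add: algebra_simps)
      also have "\<dots> \<le> (1 - p / 2) * ((1 - p / 2) ^ k * err 0)"
        using Suc.IH[OF k] p by (intro mult_left_mono) auto
      finally show ?case by simp
    qed simp
    then show ?thesis using p by (intro exI[of _ "1 - p / 2"]) auto
  qed
  have "err \<longlonglongrightarrow> 0"
  proof (rule LIMSEQ_I)
    fix r :: real assume r: "0 < r"
    obtain q where q: "0 \<le> q" "q < 1" "\<forall>k. err k \<ge> r \<longrightarrow> err k \<le> q ^ k * err 0"
      using geometric[OF r] by blast
    have "(\<lambda>k. q ^ k * err 0) \<longlonglongrightarrow> 0"
      using q(1,2) by (auto intro!: tendsto_mult_left_zero LIMSEQ_realpow_zero)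
    \<comment> \<open>Once the geometric bound is below \<open>r\<close>, the case
      \<open>err k \<ge> r\<close> contradicts it.\<close>
    then have "\<forall>\<^sub>F k in sequentially. q ^ k * err 0 < r" using r by (rule order_tendstoD)
    then obtain N where "\<And>k. N \<le> k \<Longrightarrow> q ^ k * err 0 < r"
      by (auto simp: eventually_sequentially)
    then have "\<forall>k\<ge>N. norm (err k - 0) < r"
      using q(3) err_nonneg by (auto simp: abs_of_nonneg) (meson not_le order.strict_trans2 order_less_irrefl)
    then show "\<exists>N. \<forall>k\<ge>N. norm (err k - 0) < r" by blast
  qed
  with dec geometric show ?thesis by blast
qed

end
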